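(* Let $\Delta ABC$ be a given (nondegenerate) triangle in the two-dimensional Euclidean plane, and denote by $O$ and $R$ the center and the radius of its circumcircle, respectively. Let $P$ be an arbitrary point in the plane of $\Delta ABC$, and let $\Delta A'B'C'$ be the pedal triangle of $P$ with respect to $\Delta ABC$. Then $$\frac{|\Delta A'B'C'|}{|\Delta ABC|}=\frac{|R^2-OP^2|}{4R^2}.$$
   Context: All points lie in a two-dimensional Euclidean plane. $|\Delta XYZ|$ denotes the (unsigned) area of the triangle with vertices $X,Y,Z$; it is $0$ when $X,Y,Z$ are collinear. $OP$ denotes the distance from $O$ to $P$. Given a point $P$ in the plane of a triangle $ABC$, the triangle $A'B'C'$ is called the pedal triangle of $P$ with respect to $\Delta ABC$ if $A'$, $B'$, $C'$ are the orthogonal projections of $P$ onto the lines $BC$, $AC$, $AB$, respectively (the pedal triangle may be degenerate). *)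

theory Defs
  imports "HOL-Analysis.Analysis"
begin

definition tri_area :: "real^2 \<Rightarrow> real^2 \<Rightarrow> real^2 \<Rightarrow> real" where
  "tri_area X Y Z = measure lborel (convex hull {X, Y, Z})"

definition circumcircle :: "real^2 \<Rightarrow> real^2 \<Rightarrow> real^2 \<Rightarrow> real^2 \<Rightarrow> real \<Rightarrow> bool" where
  "circumcircle A B C Q R \<longleftrightarrow> R > 0 \<and> {A, B, C} \<subseteq> sphere Q R"

text \<open>
  \<open>F\<close> is the orthogonal projection of \<open>P\<close> onto the line \<open>XY\<close>. Intended for \<open>X \<noteq> Y\<close>, where
  \<open>affine hull {X, Y}\<close> is the whole line and \<open>F\<close> exists and is unique.
\<close>
definition is_foot :: "real^2 \<Rightarrow> real^2 \<Rightarrow> real^2 \<Rightarrow> real^2 \<Rightarrow> bool" where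
  "is_foot P X Y F \<longleftrightarrow> F \<in> affine hull {X, Y} \<and> orthogonal (P - F) (Y - X)"

definition pedal_triangle ::
  "real^2 \<Rightarrow> real^2 \<Rightarrow> real^2 \<Rightarrow> real^2 \<Rightarrow> real^2 \<Rightarrow> real^2 \<Rightarrow> real^2 \<Rightarrow> bool" where
  "pedal_triangle P A B C A' B' C' \<longleftrightarrow>
     is_foot P B C A' \<and> is_foot P A C B' \<and> is_foot P A B C'"

end

theory Submission
  imports Defs
begin

text \<open>
  Put the origin at the circumcentre \<open>Q\<close>. A side such as \<open>BC\<close> is a chord, so its midpoint is the
  foot of \<open>Q\<close>, and the foot of \<open>P\<close> is displaced from this midpoint by \<open>s (C - B)\<close>, where
  \<open>s = (P - Q) \<bullet> (C - B) / |C - B|\<^sup>2\<close>. Let \<open>t\<close> and \<open>u\<close> be the corresponding numbers for the sides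
  \<open>CA\<close> and \<open>AB\<close>, the triangle being traversed cyclically. The triangle with vertices on the sides at
  these displacements has signed area \<open>1/4 + st + tu + us\<close> times that of \<open>ABC\<close>: at \<open>s = t = u = 0\<close> it
  is the medial triangle, and moving one vertex of that triangle along its side of \<open>ABC\<close>, which is
  parallel to the opposite medial side, leaves the area unchanged, so there are no linear terms.
  The theorem thus amounts to
  \<open>st + tu + us = - |P - Q|\<^sup>2 / (4 R\<^sup>2)\<close>.

  After clearing denominators, two facts give this. The first is an identity that holds for any
  three plane vectors with sum zero and any vector \<open>p\<close> (\<open>inner_products_zero_sum\<close>); it expresses
  the numerator of the left side as \<open>- |p|\<^sup>2 D\<^sup>2\<close>, where \<open>D\<close> is twice the signed area of \<open>ABC\<close>.
  The second is the classical relation between the side lengths, the area and the circumradius,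
  in the form \<open>|BC|\<^sup>2 |CA|\<^sup>2 |AB|\<^sup>2 = 4 R\<^sup>2 D\<^sup>2\<close> (\<open>sides_product_circumradius\<close>).
\<close>

definition cross2 :: "real^2 \<Rightarrow> real^2 \<Rightarrow> real" where
  "cross2 x y = x $ 1 * y $ 2 - x $ 2 * y $ 1"

lemma inner_real_2: "x \<bullet> y = x $ 1 * y $ 1 + x $ 2 * y $ 2" for x y :: "real^2"
  by (simp add: inner_vec_def sum_2)

lemma tri_area_cross2: "tri_area X Y Z = \<bar>cross2 (Y - X) (Z - X)\<bar> / 2"
  unfolding tri_area_def content_triangle cross2_def vector_minus_component
  by (simp add: abs_minus_commute algebra_simps)

text \<open>
  If the cross product vanished, one of the two vectors would be a multiple of the other, by the
  equality case of the Cauchy-Schwarz inequality.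
\<close>

lemma cross2_nonzero_of_not_collinear:
  assumes "\<not> collinear {A, B, C}"
  shows "cross2 (B - A) (C - A) \<noteq> 0"
proof
  let ?x = "B - A" and ?y = "C - A"
  assume "cross2 ?x ?y = 0"
  moreover have "(?x \<bullet> ?x) * (?y \<bullet> ?y) = (?x \<bullet> ?y)\<^sup>2 + (cross2 ?x ?y)\<^sup>2"
    unfolding inner_real_2 cross2_def by algebra
  ultimately have "(norm ?x * norm ?y)\<^sup>2 = (?x \<bullet> ?y)\<^sup>2"
    by (simp add: power_mult_distrib power2_norm_eq_inner)
  then have "\<bar>?x \<bullet> ?y\<bar> = norm ?x * norm ?y"
    by (simp add: power2_eq_iff abs_if) (smt (verit) mult_nonneg_nonneg norm_ge_zero)
  then have "collinear {0, ?x, ?y}"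
    by (simp add: norm_cauchy_schwarz_equal)
  then have "collinear {B, A, C}"
    by (subst collinear_3) simp_all
  with assms show False
    by (simp add: insert_commute)
qed

lemma is_foot_commute: "is_foot P X Y F \<longleftrightarrow> is_foot P Y X F"
  unfolding is_foot_def orthogonal_def
  by (auto simp: insert_commute inner_diff_right)

text \<open>
  The point \<open>Q\<close> lies on the perpendicular bisector of \<open>XY\<close>, so it projects to the midpoint, and
  the displacement of the foot of \<open>P\<close> from there is the projection of \<open>P - Q\<close> onto the direction
  of the line.
\<close>

lemma foot_on_chord:
  assumes foot: "is_foot P X Y F" and "X \<noteq> Y" and eq: "dist Q X = dist Q Y"
  shows "F = midpoint X Y + ((P - Q) \<bullet> (Y - X) / (norm (Y - X))\<^sup>2) *\<^sub>R (Y - X)"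
proof -
  let ?d = "Y - X"
  from foot obtain v where F: "F = X + v *\<^sub>R ?d"
    unfolding is_foot_def affine_hull_2_alt by auto
  have "(norm (X - Q))\<^sup>2 = (norm (Y - Q))\<^sup>2"
    using eq by (simp add: dist_norm norm_minus_commute)
  then have "2 * ((X - Q) \<bullet> ?d) = - (?d \<bullet> ?d)"
    by (simp add: power2_norm_eq_inner inner_diff_left inner_diff_right inner_commute algebra_simps)
  moreover have "(P - F) \<bullet> ?d = 0"
    using foot by (simp add: is_foot_def orthogonal_def)
  then have "(P - Q) \<bullet> ?d = (X - Q) \<bullet> ?d + v * (?d \<bullet> ?d)"
    by (simp add: F inner_diff_left inner_add_left)
  ultimately have "(P - Q) \<bullet> ?d = (v - 1/2) * (?d \<bullet> ?d)"
    by (simp add: algebra_simps)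
  then have coefficient: "(P - Q) \<bullet> ?d / (norm ?d)\<^sup>2 = v - 1/2"
    using \<open>X \<noteq> Y\<close> by (simp add: power2_norm_eq_inner)
  show ?thesis
    unfolding coefficient by (simp add: F midpoint_def vec_eq_iff field_simps)
qed

lemma cross2_inscribed_triangle:
  assumes "A' = midpoint B C + s *\<^sub>R (C - B)"
    and "B' = midpoint C A + t *\<^sub>R (A - C)"
    and "C' = midpoint A B + u *\<^sub>R (B - A)"
  shows "cross2 (B' - A') (C' - A') = (1/4 + s * t + t * u + u * s) * cross2 (B - A) (C - A)"
  unfolding assms cross2_def midpoint_def by (simp add: field_simps)

text \<open>
  Both sides are quadratic forms in \<open>p\<close>. Taking \<open>p\<close> perpendicular to \<open>a\<close> shows why
  this holds: there \<open>p \<bullet> c = - (p \<bullet> b)\<close>, and only the term \<open>- (p \<bullet> b)\<^sup>2 |a|\<^sup>2 = - |p|\<^sup>2 (cross2 a b)\<^sup>2\<close>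
  survives. The same happens for \<open>b\<close> and \<open>c\<close>, and a quadratic form in the plane is determined by its
  values in three pairwise independent directions. In coordinates the claim is a polynomial
  identity, which also covers parallel \<open>a\<close>, \<open>b\<close>, \<open>c\<close>.
\<close>

lemma inner_products_zero_sum:
  assumes "a + b + c = 0"
  shows "(p \<bullet> a) * (p \<bullet> b) * (c \<bullet> c) + (p \<bullet> b) * (p \<bullet> c) * (a \<bullet> a) + (p \<bullet> c) * (p \<bullet> a) * (b \<bullet> b)
    = - (p \<bullet> p) * (cross2 a b)\<^sup>2"
proof -
  have c: "c = - a - b"
    using assms by (simp add: algebra_simps add_eq_0_iff)
  show ?thesis
    unfolding c inner_real_2 cross2_def vector_minus_component vector_uminus_component by algebra
qed

text \<open>
  Seen from \<open>A\<close>, the centre \<open>q = Q - A\<close> satisfies \<open>2 (q \<bullet> x) = |x|\<^sup>2\<close> and \<open>2 (q \<bullet> y) = |y|\<^sup>2\<close> for the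
  side vectors \<open>x = B - A\<close> and \<open>y = C - A\<close>. The vector \<open>(q \<bullet> x) y - (q \<bullet> y) x\<close> is \<open>q\<close> turned by a
  right angle and scaled by the cross product of \<open>x\<close> and \<open>y\<close>. Comparing squared lengths yields
  \<open>R\<^sup>2 (cross2 x y)\<^sup>2 = |x|\<^sup>2 |y|\<^sup>2 |x - y|\<^sup>2 / 4\<close>.
\<close>

lemma sides_product_circumradius:
  fixes A B C Q :: "real^2"
  assumes "dist Q A = R" "dist Q B = R" "dist Q C = R"
  shows "(norm (C - B))\<^sup>2 * (norm (A - C))\<^sup>2 * (norm (B - A))\<^sup>2
    = 4 * R\<^sup>2 * (cross2 (B - A) (C - A))\<^sup>2"
proof -
  define q x y where "q = Q - A" and "x = B - A" and "y = C - A"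
  have R: "R\<^sup>2 = q \<bullet> q"
    unfolding assms(1)[symmetric] by (simp add: q_def dist_norm power2_norm_eq_inner)
  have "R\<^sup>2 = (q - x) \<bullet> (q - x)"
    unfolding assms(2)[symmetric] by (simp add: q_def x_def dist_norm power2_norm_eq_inner)
  moreover have "R\<^sup>2 = (q - y) \<bullet> (q - y)"
    unfolding assms(3)[symmetric] by (simp add: q_def y_def dist_norm power2_norm_eq_inner)
  ultimately have x: "x \<bullet> x = 2 * (q \<bullet> x)" and y: "y \<bullet> y = 2 * (q \<bullet> y)"
    using R by (simp_all add: inner_diff_left inner_diff_right inner_commute)
  let ?w = "(q \<bullet> x) *\<^sub>R y - (q \<bullet> y) *\<^sub>R x"
  have turned: "?w \<bullet> ?w = (q \<bullet> q) * (cross2 x y)\<^sup>2"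
    unfolding inner_real_2 cross2_def vector_minus_component vector_scaleR_component real_scaleR_def
    by algebra
  have "?w \<bullet> ?w = (q \<bullet> x)\<^sup>2 * (y \<bullet> y) + (q \<bullet> y)\<^sup>2 * (x \<bullet> x) - 2 * (q \<bullet> x) * (q \<bullet> y) * (x \<bullet> y)"
    by (simp add: inner_diff_left inner_diff_right inner_commute power2_eq_square algebra_simps)
  then have "4 * (?w \<bullet> ?w) = (x \<bullet> x) * (y \<bullet> y) * (x \<bullet> x + y \<bullet> y - 2 * (x \<bullet> y))"
    unfolding x y by algebra
  also have "x \<bullet> x + y \<bullet> y - 2 * (x \<bullet> y) = (norm (C - B))\<^sup>2"
    by (simp add: x_def y_def power2_norm_eq_inner inner_diff_left inner_diff_right inner_commute)
  also have "x \<bullet> x = (norm (B - A))\<^sup>2"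
    by (simp add: x_def power2_norm_eq_inner)
  also have "y \<bullet> y = (norm (A - C))\<^sup>2"
    by (simp add: y_def norm_minus_commute flip: power2_norm_eq_inner)
  finally show ?thesis
    unfolding turned R[symmetric] x_def[symmetric] y_def[symmetric] by (simp add: mult_ac)
qed

theorem theorem1p1:
  fixes A B C P Q A' B' C' :: "real^2" and R :: real
  assumes "\<not> collinear {A, B, C}"
    and "circumcircle A B C Q R"
    and "pedal_triangle P A B C A' B' C'"
  shows "tri_area A' B' C' / tri_area A B C = \<bar>R\<^sup>2 - (dist Q P)\<^sup>2\<bar> / (4 * R\<^sup>2)"
proof -
  define p a b c where "p = P - Q" and "a = C - B" and "b = A - C" and "c = B - A"
  define D where "D = cross2 (B - A) (C - A)"
  define s t u where "s = p \<bullet> a / (norm a)\<^sup>2" and "t = p \<bullet> b / (norm b)\<^sup>2" and "u = p \<bullet> c / (norm c)\<^sup>2"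
  have "R > 0" and radii: "dist Q A = R" "dist Q B = R" "dist Q C = R"
    using assms(2) by (auto simp: circumcircle_def)
  have "D \<noteq> 0"
    unfolding D_def using assms(1) by (rule cross2_nonzero_of_not_collinear)
  have "A \<noteq> B" "B \<noteq> C" "C \<noteq> A"
    using assms(1) by (auto simp: insert_commute)
  then have nonzero: "norm a \<noteq> 0" "norm b \<noteq> 0" "norm c \<noteq> 0"
    by (simp_all add: a_def b_def c_def)
  have feet: "is_foot P B C A'" "is_foot P C A B'" "is_foot P A B C'"
    using assms(3) is_foot_commute by (auto simp: pedal_triangle_def)
  have "A' = midpoint B C + s *\<^sub>R (C - B)"
    using foot_on_chord[OF feet(1), of Q] \<open>B \<noteq> C\<close> radii by (simp add: s_def p_def a_def)
  moreover have "B' = midpoint C A + t *\<^sub>R (A - C)"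
    using foot_on_chord[OF feet(2), of Q] \<open>C \<noteq> A\<close> radii by (simp add: t_def p_def b_def)
  moreover have "C' = midpoint A B + u *\<^sub>R (B - A)"
    using foot_on_chord[OF feet(3), of Q] \<open>A \<noteq> B\<close> radii by (simp add: u_def p_def c_def)
  ultimately have pedal: "cross2 (B' - A') (C' - A') = (1/4 + s * t + t * u + u * s) * D"
    unfolding D_def by (rule cross2_inscribed_triangle)
  let ?N = "(norm a)\<^sup>2 * (norm b)\<^sup>2 * (norm c)\<^sup>2"
  have N: "?N = 4 * R\<^sup>2 * D\<^sup>2"
    unfolding a_def b_def c_def D_def using radii by (rule sides_product_circumradius)
  have "(s * t + t * u + u * s) * ?N
      = (p \<bullet> a) * (p \<bullet> b) * (norm c)\<^sup>2 + (p \<bullet> b) * (p \<bullet> c) * (norm a)\<^sup>2 + (p \<bullet> c) * (p \<bullet> a) * (norm b)\<^sup>2"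
    using nonzero by (simp add: s_def t_def u_def field_simps)
  also have "\<dots> = - (p \<bullet> p) * (cross2 a b)\<^sup>2"
    unfolding power2_norm_eq_inner by (rule inner_products_zero_sum) (simp add: a_def b_def c_def)
  also have "cross2 a b = D"
    unfolding a_def b_def D_def cross2_def by (simp add: algebra_simps)
  also have "p \<bullet> p = (dist Q P)\<^sup>2"
    by (simp add: p_def dist_norm norm_minus_commute flip: power2_norm_eq_inner)
  finally have "((s * t + t * u + u * s) * (4 * R\<^sup>2)) * D\<^sup>2 = - (dist Q P)\<^sup>2 * D\<^sup>2"
    unfolding N by (simp only: mult.assoc)
  then have "(s * t + t * u + u * s) * (4 * R\<^sup>2) = - (dist Q P)\<^sup>2"
    using \<open>D \<noteq> 0\<close> by (simp only: mult_cancel_right) simp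
  then have "1/4 + s * t + t * u + u * s = (R\<^sup>2 - (dist Q P)\<^sup>2) / (4 * R\<^sup>2)"
    using \<open>R > 0\<close> by (simp add: field_simps)
  then have "tri_area A' B' C' / tri_area A B C = \<bar>(R\<^sup>2 - (dist Q P)\<^sup>2) / (4 * R\<^sup>2)\<bar>"
    unfolding tri_area_cross2 pedal using \<open>D \<noteq> 0\<close> by (simp add: abs_mult flip: D_def)
  then show ?thesis
    by (simp add: abs_divide)
qed

end
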